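(* Let $X$ be a Hilbert space, let $f: X \to (-\infty, \infty]$ be a proper, weakly lower semi-continuous function and let $\bar x \in \mathrm{dom}(f)$. If there exist $r>0$, $\eta>0$ and a desingularizing function $\varphi\in \mathcal{K}(0, \eta)$ such that $$\varphi'(f(x) - f(\bar x))\, d(0, \hat\partial f(x)) \ge 1$$ for all $x \in B_r(\bar x)$ with $f(\bar x) < f(x) < f(\bar x) + \eta$, then there exist $0<\tilde r\le r$ and $0<\tilde \eta \le \eta$ such that $$d(x, S) \le 2 \varphi(f(x) - f(\bar x))$$ for all $x \in B_{\tilde r}(\bar x)$ with $f(\bar x) \le f(x) < f(\bar x) + \tilde \eta$, where $S:=\{x \in X: f(x) \le f(\bar x)\}$.
   Context: $X$ is a (real) Hilbert space. $\mathrm{dom}(f):=\{x\in X: f(x)<\infty\}$. $B_r(\bar x)$ denotes the open ball of radius $r$ centered at $\bar x$. For a set $A\subset X$, $d(x,A):=\inf_{z\in A}\|x-z\|$, with $d(x,\emptyset)=+\infty$. For a proper function $f:X\to(-\infty,\infty]$, the Fréchet subdifferential $\hat\partial f(x)$ at $x\in\mathrm{dom}(f)$ is the set of all $\xi\in X$ satisfying $$\liminf_{y\ne x,\ y\to x} \frac{f(y) - f(x) - \langle \xi, y-x\rangle}{\|y - x\|} \ge 0,$$ and $\hat\partial f(x)=\emptyset$ for $x\notin \mathrm{dom}(f)$. For $\eta\in(0,\infty]$, the class of desingularizing functions is $$\mathcal{K}(0, \eta) := \{\varphi \in C[0, \eta) \cap C^1(0, \eta): \varphi(0) =0,\ \varphi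 \text{ is concave},\ \varphi'(s)>0 \text{ for } s\in(0,\eta)\}.$$ *)

theory Defs
  imports "HOL-Analysis.Analysis"
begin

text \<open>
  Hilbert spaces are types of class \<open>{real_inner, complete_space}\<close>.
  A function with values in \<open>(-\<infinity>, \<infinity>]\<close> is an \<open>ereal\<close>-valued function that is nowhere \<open>-\<infinity>\<close>.
\<close>

definition edom :: "('a \<Rightarrow> ereal) \<Rightarrow> 'a set"
  where "edom f = {x. f x < \<infinity>}"

definition proper :: "('a \<Rightarrow> ereal) \<Rightarrow> bool"
  where "proper f \<longleftrightarrow> (\<forall>x. f x \<noteq> -\<infinity>) \<and> edom f \<noteq> {}"

text \<open>The coarsest topology making every bounded linear functional continuous.\<close>

definition weak_topology :: "'a::real_normed_vector topology"
  where "weak_topology =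
    topology_generated_by {g -` U |(g :: 'a \<Rightarrow> real) U. bounded_linear g \<and> open U}"

definition lower_semicontinuous_in :: "'a topology \<Rightarrow> ('a \<Rightarrow> ereal) \<Rightarrow> bool"
  where "lower_semicontinuous_in T f \<longleftrightarrow> (\<forall>c. openin T {x \<in> topspace T. c < f x})"

definition weakly_lsc :: "('a::real_normed_vector \<Rightarrow> ereal) \<Rightarrow> bool"
  where "weakly_lsc f \<longleftrightarrow> lower_semicontinuous_in weak_topology f"

text \<open>
  Unlike \<^const>\<open>infdist\<close>, the distance is extended-real-valued, so that the distance to the
  empty set is \<open>\<infinity>\<close> (the infimum of the empty set in \<^typ>\<open>ereal\<close>).
\<close>

definition edist_set :: "'a::real_normed_vector \<Rightarrow> 'a set \<Rightarrow> ereal"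
  where "edist_set x A = (INF z\<in>A. ereal (norm (x - z)))"

definition frechet_subdiff :: "('a::real_inner \<Rightarrow> ereal) \<Rightarrow> 'a \<Rightarrow> 'a set"
  where "frechet_subdiff f x =
    (if x \<in> edom f
     then {\<xi>. Liminf (at x) (\<lambda>y. (f y - f x - ereal (inner \<xi> (y - x))) / ereal (norm (y - x))) \<ge> 0}
     else {})"

text \<open>
  The right endpoint \<open>\<eta>\<close> may be \<open>\<infinity>\<close>. Only the values of \<open>\<phi>\<close> on \<open>[0, \<eta>)\<close> matter.
\<close>

definition desingularizing :: "ereal \<Rightarrow> (real \<Rightarrow> real) set"
  where "desingularizing \<eta> = {\<phi>.
    continuous_on {s. 0 \<le> s \<and> ereal s < \<eta>} \<phi> \<and>
    (\<forall>s. 0 < s \<and> ereal s < \<eta> \<longrightarrow> \<phi> differentiable (at s)) \<and>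
    continuous_on {s. 0 < s \<and> ereal s < \<eta>} (deriv \<phi>) \<and>
    \<phi> 0 = 0 \<and>
    concave_on {s. 0 \<le> s \<and> ereal s < \<eta>} \<phi> \<and>
    (\<forall>s. 0 < s \<and> ereal s < \<eta> \<longrightarrow> deriv \<phi> s > 0)}"

end

theory Submission
  imports Defs
begin

text \<open>
  Let \<open>x\<close> be a point near \<open>xbar\<close> with \<open>f x > f xbar\<close>, put \<open>t = \<phi> (f x - f xbar)\<close>, and suppose that
  no point of the sublevel set \<open>S\<close> lies within some \<open>\<rho> > 2 * t\<close> of \<open>x\<close>.  Let \<open>H\<close> be the composition
  of \<open>\<phi>\<close> with \<open>f - f xbar\<close>, cut off below at \<open>0\<close> and above at a level \<open>m < \<eta>\<close> so that it is real
  and defined everywhere.  Penalize the distance from \<open>x\<close> by minimizing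
  \<open>H y + k * (norm (y - x))\<^sup>2\<close> with \<open>k = t / \<rho>\<^sup>2\<close>.  Since this function equals \<open>t\<close> at \<open>x\<close>,
  a minimizer \<open>v\<close> satisfies \<open>norm (v - x) \<le> \<rho>\<close>, hence \<open>v\<close> is not in \<open>S\<close>; and
  stationarity gives \<open>H\<close> a subgradient at \<open>v\<close> of norm at most \<open>2 * k * \<rho> = 2 * t / \<rho> < 1\<close>.
  Dividing by \<open>\<phi>'\<close> turns it into a Frechet subgradient of \<open>f\<close>, which contradicts the
  assumption \<open>\<phi>' * d(0, \<partial>f) \<ge> 1\<close>.  The constant \<open>2\<close> is the derivative of the square.

  Because \<open>\<rho> > 2 * t\<close> leaves room, an exact minimizer can be replaced by an approximately
  stationary point.  Such points exist for every lower semicontinuous function that is bounded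
  below (\<open>small_proximal_subgradient_exists\<close>, a form of the Borwein-Preiss variational
  principle).  It is applied in the norm topology: a weakly open superlevel set of \<open>f\<close> is also
  norm open.

  The passage from \<open>H\<close> to \<open>f\<close> (\<open>frechet_subgradient_of_desingularized\<close>) is an inequality and not a
  chain rule: a concave \<open>\<phi>\<close> lies below its tangent, so a quadratic minorant of \<open>H\<close> at \<open>v\<close>
  yields one of \<open>f\<close>.

  Finally, \<open>xbar\<close> itself belongs to \<open>S\<close>, so \<open>\<rho> < norm (x - xbar)\<close>; halving the radius
  therefore keeps \<open>v\<close> in the ball on which the assumption applies.
\<close>

section \<open>A smooth variational principle\<close>

lemma near_minimizer_exists:
  fixes F :: "'a \<Rightarrow> real"
  assumes bdd: "\<And>y. b \<le> F y" and "\<delta> > 0"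
  shows "\<exists>z. F z \<le> F z0 \<and> (\<forall>y. F z \<le> F y + \<delta>)"
proof (cases "\<forall>y. F z0 \<le> F y + \<delta>")
  case True
  then show ?thesis by blast
next
  case False
  then obtain y0 where y0: "F y0 + \<delta> < F z0" by (auto simp: not_le)
  have bb: "bdd_below (range F)" using bdd by (intro bdd_belowI[of _ b]) auto
  have "Inf (range F) < Inf (range F) + \<delta>" using \<open>\<delta> > 0\<close> by simp
  then obtain z where z: "F z < Inf (range F) + \<delta>"
    using cInf_lessD[of "range F"] by blast
  have *: "Inf (range F) \<le> F y" for y using bb by (rule cInf_lower[rotated]) simp
  have "F z \<le> F y + \<delta>" for y using z *[of y] by linarith
  moreover have "F z \<le> F z0" using z *[of y0] y0 by linarith
  ultimately show ?thesis by blast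
qed

text \<open>
  The sort of \<open>'a\<close> here is that of a complete normed space without the class \<open>banach\<close>, so the
  Cauchy property is derived by hand instead of from summability of the increments.
\<close>

lemma geometric_increments_converge:
  fixes z :: "nat \<Rightarrow> 'a::{real_normed_vector, complete_space}"
  assumes inc: "\<And>n. norm (z (Suc n) - z n) \<le> C * (1/2) ^ n"
  obtains v where "z \<longlonglongrightarrow> v" and "\<And>n. norm (v - z n) \<le> 2 * C * (1/2) ^ n"
proof -
  have C: "C \<ge> 0" using order_trans[OF norm_ge_zero inc[of 0]] by simp
  have step: "norm (z (n + k) - z n) \<le> 2 * C * (1/2) ^ n * (1 - (1/2) ^ k)" for n k
  proof (induction k)
    case (Suc k)
    have "norm (z (n + Suc k) - z n) \<le> norm (z (Suc (n + k)) - z (n + k)) + norm (z (n + k) - z n)"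
      using norm_triangle_ineq[of "z (Suc (n + k)) - z (n + k)" "z (n + k) - z n"] by simp
    also have "\<dots> \<le> C * (1/2) ^ (n + k) + 2 * C * (1/2) ^ n * (1 - (1/2) ^ k)"
      using inc[of "n + k"] Suc by linarith
    also have "\<dots> = 2 * C * (1/2) ^ n * (1 - (1/2) ^ Suc k)"
      by (simp add: power_add field_simps)
    finally show ?case .
  qed simp
  have tail: "norm (z m - z n) \<le> 2 * C * (1/2) ^ n" if "n \<le> m" for m n
  proof -
    have "2 * C * (1/2) ^ n * (1 - (1/2) ^ (m - n)) \<le> 2 * C * (1/2) ^ n * 1"
      using C by (intro mult_left_mono) auto
    then show ?thesis using step[of n "m - n"] that by simp
  qed
  have lim0: "(\<lambda>n. 2 * C * (1/2::real) ^ n) \<longlonglongrightarrow> 0"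
    by (intro tendsto_mult_right_zero LIMSEQ_power_zero) simp
  have "Cauchy z"
  proof (rule metric_CauchyI)
    fix e :: real assume "e > 0"
    then have "\<forall>\<^sub>F n in sequentially. 2 * C * (1/2) ^ n < e / 2"
      using order_tendstoD(2)[OF lim0, of "e / 2"] by simp
    then obtain N where N: "2 * C * (1/2) ^ N < e / 2"
      by (auto simp: eventually_sequentially)
    have "dist (z m) (z n) < e" if "m \<ge> N" "n \<ge> N" for m n
    proof -
      have "dist (z m) (z n) \<le> dist (z m) (z N) + dist (z n) (z N)"
        by (rule dist_triangle2)
      then show ?thesis using tail[OF that(1)] tail[OF that(2)] N by (simp add: dist_norm)
    qed
    then show "\<exists>M. \<forall>m\<ge>M. \<forall>n\<ge>M. dist (z m) (z n) < e" by blast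
  qed
  then obtain v where v: "z \<longlonglongrightarrow> v"
    by (auto simp: Cauchy_convergent_iff convergent_def)
  have "norm (v - z n) \<le> 2 * C * (1/2) ^ n" for n
  proof (rule LIMSEQ_le_const2)
    show "(\<lambda>m. norm (z m - z n)) \<longlonglongrightarrow> norm (v - z n)"
      by (intro tendsto_intros v)
    show "\<exists>N. \<forall>m\<ge>N. norm (z m - z n) \<le> 2 * C * (1/2) ^ n"
      using tail by blast
  qed
  with v show thesis by (rule that)
qed

lemma lsc_le_limit:
  fixes G :: "'a::topological_space \<Rightarrow> real"
  assumes lsc: "\<And>a. open {x. a < G x}"
    and z: "z \<longlonglongrightarrow> v" and b: "b \<longlonglongrightarrow> B"
    and le: "\<forall>\<^sub>F k in sequentially. G (z k) \<le> b k"
  shows "G v \<le> B"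
proof (rule ccontr)
  assume "\<not> G v \<le> B"
  then obtain c where c: "B < c" "c < G v" using dense[of B "G v"] by (auto simp: not_le)
  have "\<forall>\<^sub>F k in sequentially. z k \<in> {x. c < G x}"
    using topological_tendstoD[OF z lsc[of c]] c by simp
  moreover have "\<forall>\<^sub>F k in sequentially. b k < c"
    using order_tendstoD(2)[OF b c(1)] .
  ultimately have "\<forall>\<^sub>F k in sequentially. False"
    using le by eventually_elim auto
  then show False by simp
qed

text \<open>
  Starting with \<open>\<Phi> 0 = G\<close>, pick an almost minimizer \<open>z n\<close> of \<open>\<Phi> n\<close> up to the error \<open>\<delta> n\<close> and put
  \<open>\<Phi> (n + 1) y = \<Phi> n y + e n * (norm (y - z n))\<^sup>2\<close>.  The new term penalizes departure from
  \<open>z n\<close>, so the next almost minimizer is within \<open>sqrt (\<delta> n / e n)\<close> of it and the points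
  converge to some \<open>v\<close>.  Lower semicontinuity gives \<open>\<Phi> n v \<le> \<Phi> n (z n)\<close> for every \<open>n\<close>, so \<open>v\<close>
  minimizes every \<open>\<Phi> n\<close> up to \<open>\<delta> n\<close>.  Expanding the accumulated quadratic terms
  around \<open>v\<close> and letting \<open>n\<close> grow leaves a quadratic minorant of \<open>G\<close> whose slope and
  curvature are controlled by the sum of the weights \<open>e n\<close>.
\<close>

lemma small_proximal_subgradient_exists:
  fixes G :: "'a::{real_inner, complete_space} \<Rightarrow> real"
  assumes lsc: "\<And>a. open {x. a < G x}"
    and bdd: "\<And>y. b \<le> G y"
    and "\<epsilon> > 0"
  obtains v p where "G v \<le> G x" and "norm p \<le> \<epsilon>"
    and "\<And>y. G v + inner p (y - v) - \<epsilon> * (norm (y - v))\<^sup>2 \<le> G y"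
proof -
  \<comment> \<open>The quotient \<open>\<delta> n / e n\<close> is the square of \<open>(1/2) ^ n\<close>, which bounds the step from \<open>z n\<close>;
    the factor \<open>1/8\<close> makes the slope below at most \<open>\<epsilon>\<close>.\<close>
  define e where "e n = \<epsilon> / 8 * (1/2) ^ n" for n :: nat
  define \<delta> where "\<delta> n = e n * (1/4) ^ n" for n
  have e_pos: "e n > 0" and \<delta>_pos: "\<delta> n > 0" for n
    using \<open>\<epsilon> > 0\<close> by (auto simp: e_def \<delta>_def)
  \<comment> \<open>A state pairs a perturbed function with an almost minimizer of it; \<open>P\<close> holds of the
    \<open>n\<close>-th state and \<open>Q\<close> relates consecutive ones.\<close>
  define P :: "nat \<Rightarrow> ('a \<Rightarrow> real) \<times> 'a \<Rightarrow> bool" where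
    "P n s \<longleftrightarrow> (n = 0 \<longrightarrow> fst s = G) \<and> (\<forall>y. G y \<le> fst s y) \<and> fst s (snd s) \<le> G x \<and>
      (\<forall>y. fst s (snd s) \<le> fst s y + \<delta> n)" for n s
  define Q :: "nat \<Rightarrow> ('a \<Rightarrow> real) \<times> 'a \<Rightarrow> ('a \<Rightarrow> real) \<times> 'a \<Rightarrow> bool" where
    "Q n s s' \<longleftrightarrow> fst s' = (\<lambda>y. fst s y + e n * (norm (y - snd s))\<^sup>2) \<and>
      fst s' (snd s') \<le> fst s (snd s)" for n s s'
  have "\<exists>S. \<forall>n. P n (S n) \<and> Q n (S n) (S (Suc n))"
  proof (rule dependent_nat_choice)
    show "\<exists>s. P 0 s"
      using near_minimizer_exists[of b G "\<delta> 0" x] bdd \<delta>_pos by (auto simp: P_def)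
  next
    fix s n assume Pn: "P n s"
    define F where "F y = fst s y + e n * (norm (y - snd s))\<^sup>2" for y
    have GF: "G y \<le> F y" for y
      using Pn e_pos[of n] by (auto simp: P_def F_def intro: add_increasing2)
    then have "b \<le> F y" for y using bdd order_trans by blast
    from near_minimizer_exists[of b F "\<delta> (Suc n)" "snd s", OF this \<delta>_pos]
    obtain z where z: "F z \<le> F (snd s)" "\<And>y. F z \<le> F y + \<delta> (Suc n)" by blast
    have "F (snd s) = fst s (snd s)" by (simp add: F_def)
    then have "P (Suc n) (F, z) \<and> Q n s (F, z)"
      using z GF Pn by (auto simp: P_def Q_def F_def)
    then show "\<exists>s'. P (Suc n) s' \<and> Q n s s'" by blast
  qed
  then obtain S where S: "\<And>n. P n (S n)" "\<And>n. Q n (S n) (S (Suc n))" by blast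
  define \<Phi> where "\<Phi> n = fst (S n)" for n
  define z where "z n = snd (S n)" for n
  have \<Phi>0: "\<Phi> 0 = G" and \<Phi>_x: "\<Phi> 0 (z 0) \<le> G x"
    and near: "\<Phi> n (z n) \<le> \<Phi> n y + \<delta> n" for n y
    using S(1)[of 0] S(1)[of n] by (auto simp: P_def \<Phi>_def z_def)
  have \<Phi>_Suc: "\<Phi> (Suc n) y = \<Phi> n y + e n * (norm (y - z n))\<^sup>2"
    and dec: "\<Phi> (Suc n) (z (Suc n)) \<le> \<Phi> n (z n)" for n y
    using S(2)[of n] by (auto simp: Q_def \<Phi>_def z_def)
  have \<Phi>: "\<Phi> n y = G y + (\<Sum>i<n. e i * (norm (y - z i))\<^sup>2)" for n y
    by (induction n) (simp_all add: \<Phi>0 \<Phi>_Suc)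
  have inc: "norm (z (Suc n) - z n) \<le> 1 * (1/2) ^ n" for n
  proof -
    have "e n * (norm (z (Suc n) - z n))\<^sup>2 \<le> e n * (1/4) ^ n"
      using near[of n "z (Suc n)"] dec[of n] \<Phi>_Suc[of n "z (Suc n)"]
      by (simp add: \<delta>_def)
    then have "(norm (z (Suc n) - z n))\<^sup>2 \<le> (1/4) ^ n"
      using e_pos[of n] by simp
    also have "(1/4::real) ^ n = ((1/2) ^ n)\<^sup>2"
      by (simp add: power2_eq_square flip: power_mult_distrib)
    finally show ?thesis by (simp only: mult_1_left) (rule power2_le_imp_le, simp_all)
  qed
  obtain v where v: "z \<longlonglongrightarrow> v" and vz: "\<And>n. norm (v - z n) \<le> 2 * 1 * (1/2) ^ n"
    using geometric_increments_converge[OF inc] by blast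
  have \<Phi>_v: "\<Phi> n v \<le> \<Phi> n (z n)" for n
  proof -
    let ?q = "\<lambda>y. \<Sum>i<n. e i * (norm (y - z i))\<^sup>2"
    have mono: "\<Phi> n y \<le> \<Phi> k y" if "n \<le> k" for k y
      using that by (induction k rule: dec_induct)
        (use e_pos \<Phi>_Suc in \<open>auto intro: order_trans simp: less_imp_le\<close>)
    have "\<Phi> n (z k) \<le> \<Phi> n (z n)" if "n \<le> k" for k
    proof -
      have "\<Phi> k (z k) \<le> \<Phi> n (z n)"
        using lift_Suc_antimono_le[of "\<lambda>k. \<Phi> k (z k)", OF dec that] .
      then show ?thesis using mono[OF that, of "z k"] by linarith
    qed
    then have "\<forall>\<^sub>F k in sequentially. G (z k) \<le> \<Phi> n (z n) - ?q (z k)"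
      unfolding eventually_sequentially by (intro exI[of _ n]) (auto simp: \<Phi>[of n] le_diff_eq)
    moreover have "(\<lambda>k. \<Phi> n (z n) - ?q (z k)) \<longlonglongrightarrow> \<Phi> n (z n) - ?q v"
      by (intro tendsto_intros v)
    ultimately have "G v \<le> \<Phi> n (z n) - ?q v"
      using lsc_le_limit[OF lsc v] by blast
    then show ?thesis by (simp add: \<Phi>[of n v])
  qed
  \<comment> \<open>The negative gradient at \<open>v\<close> of the quadratic terms accumulated in \<open>\<Phi> n\<close>.\<close>
  define p where "p n = - (\<Sum>i<n. (2 * e i) *\<^sub>R (v - z i))" for n
  have "norm (p (Suc n) - p n) \<le> \<epsilon> / 2 * (1/2) ^ n" for n
  proof -
    have "norm (p (Suc n) - p n) = 2 * e n * norm (v - z n)"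
      using e_pos[of n] by (simp add: p_def)
    also have "\<dots> \<le> 2 * e n * 2"
    proof (intro mult_left_mono)
      have "(1/2::real) ^ n \<le> 1" by (simp add: power_le_one)
      then show "norm (v - z n) \<le> 2" using vz[of n] by linarith
    qed (use e_pos[of n] in simp)
    finally show ?thesis by (simp add: e_def)
  qed
  then obtain q where q: "p \<longlonglongrightarrow> q" and q_bound: "\<And>n. norm (q - p n) \<le> 2 * (\<epsilon> / 2) * (1/2) ^ n"
    using geometric_increments_converge by blast
  show thesis
  proof (rule that)
    show "G v \<le> G x" using \<Phi>_v[of 0] \<Phi>_x by (simp add: \<Phi>0)
    show "norm q \<le> \<epsilon>" using q_bound[of 0] by (simp add: p_def)
    fix y
    have "(\<Sum>i<n. e i) \<le> \<epsilon>" for n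
    proof -
      have "(\<Sum>i<n. e i) = \<epsilon> / 4 * (1 - (1/2) ^ n)"
        by (induction n) (simp_all add: e_def field_simps)
      also have "\<dots> \<le> \<epsilon> / 4 * 1" using \<open>\<epsilon> > 0\<close> by (intro mult_left_mono) auto
      finally show ?thesis using \<open>\<epsilon> > 0\<close> by simp
    qed
    then have A: "(\<Sum>i<n. e i) * (norm (y - v))\<^sup>2 \<le> \<epsilon> * (norm (y - v))\<^sup>2" for n
      by (intro mult_right_mono) auto
    have expand: "\<Phi> n y - \<Phi> n v
        = G y - G v + (\<Sum>i<n. e i) * (norm (y - v))\<^sup>2 - inner (p n) (y - v)" for n
    proof -
      have "e i * (norm (y - z i))\<^sup>2 - e i * (norm (v - z i))\<^sup>2
          = e i * (norm (y - v))\<^sup>2 + inner ((2 * e i) *\<^sub>R (v - z i)) (y - v)" for i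
        by (simp add: power2_norm_eq_inner inner_diff inner_commute algebra_simps)
      then have "(\<Sum>i<n. e i * (norm (y - z i))\<^sup>2) - (\<Sum>i<n. e i * (norm (v - z i))\<^sup>2)
          = (\<Sum>i<n. e i) * (norm (y - v))\<^sup>2 + inner (\<Sum>i<n. (2 * e i) *\<^sub>R (v - z i)) (y - v)"
        by (simp only: sum_subtractf[symmetric] sum.distrib inner_sum_left sum_distrib_right)
      then show ?thesis by (simp add: \<Phi> p_def)
    qed
    have "G v + inner (p n) (y - v) - \<epsilon> * (norm (y - v))\<^sup>2 \<le> G y + \<delta> n" for n
      using expand[of n] A[of n] \<Phi>_v[of n] near[of n y] by linarith
    moreover have "(\<lambda>n. G v + inner (p n) (y - v) - \<epsilon> * (norm (y - v))\<^sup>2)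
        \<longlonglongrightarrow> G v + inner q (y - v) - \<epsilon> * (norm (y - v))\<^sup>2"
      by (intro tendsto_intros q)
    moreover have "(\<lambda>n. G y + \<delta> n) \<longlonglongrightarrow> G y + \<epsilon> / 8 * 0 * 0"
      unfolding \<delta>_def e_def by (intro tendsto_intros LIMSEQ_power_zero) simp_all
    ultimately show "G v + inner q (y - v) - \<epsilon> * (norm (y - v))\<^sup>2 \<le> G y"
      using LIMSEQ_le by fastforce
  qed
qed

section \<open>Weak lower semicontinuity and Frechet subgradients\<close>

lemma open_if_weakly_open:
  assumes "openin weak_topology U"
  shows "open U"
proof -
  have "generate_topology_on {g -` U |(g :: 'a \<Rightarrow> real) U. bounded_linear g \<and> open U} U"
    using assms unfolding weak_topology_def by (simp add: openin_topology_generated_by_iff)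
  then show ?thesis
  proof (induction rule: generate_topology_on.induct)
    case (Basis s)
    then obtain g :: "'a \<Rightarrow> real" and V where s: "s = g -` V" "bounded_linear g" "open V"
      by blast
    then have "continuous_on UNIV g" by (simp add: linear_continuous_on)
    with s show ?case by (simp add: open_vimage)
  qed auto
qed

lemma weakly_lsc_imp_open_superlevel:
  fixes f :: "'a::real_normed_vector \<Rightarrow> ereal"
  assumes "weakly_lsc f"
  shows "open {x. c < f x}"
proof -
  have "openin weak_topology (((\<lambda>_. 0) :: 'a \<Rightarrow> real) -` UNIV)"
    unfolding weak_topology_def openin_topology_generated_by_iff
    by (rule generate_topology_on.Basis) (use bounded_linear_zero in blast)
  then have "openin weak_topology (UNIV :: 'a set)" by simp
  then have "topspace weak_topology = (UNIV :: 'a set)"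
    using openin_subset by blast
  then have "openin weak_topology {x. c < f x}"
    using assms unfolding weakly_lsc_def lower_semicontinuous_in_def by simp
  then show ?thesis by (rule open_if_weakly_open)
qed

text \<open>
  A quadratic error term is negligible against \<open>norm (y - v)\<close>, so every proximal subgradient is a
  Frechet subgradient.
\<close>

lemma frechet_subdiffI_quadratic:
  fixes f :: "'a::real_inner \<Rightarrow> ereal"
  assumes fv: "f v = ereal w"
    and minorant: "\<forall>\<^sub>F y in at v. ereal (w + inner \<zeta> (y - v) - K * (norm (y - v))\<^sup>2) \<le> f y"
  shows "\<zeta> \<in> frechet_subdiff f v"
proof -
  let ?q = "\<lambda>y. (f y - f v - ereal (inner \<zeta> (y - v))) / ereal (norm (y - v))"
  have "((\<lambda>y. ereal (- K * norm (y - v))) \<longlongrightarrow> ereal (- K * norm (v - v))) (at v)"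
    by (intro tendsto_intros)
  then have lim: "((\<lambda>y. ereal (- K * norm (y - v))) \<longlongrightarrow> 0) (at v)"
    by (simp add: zero_ereal_def)
  have "\<forall>\<^sub>F y in at v. ereal (- K * norm (y - v)) \<le> ?q y"
    using minorant eventually_neq_at_within[of v v UNIV]
  proof eventually_elim
    case (elim y)
    then have n: "norm (y - v) > 0" by simp
    show ?case
    proof (cases "f y")
      case (real u)
      have "- K * norm (y - v) * norm (y - v) \<le> u - w - inner \<zeta> (y - v)"
        using elim real by (simp add: power2_eq_square)
      then have "- K * norm (y - v) \<le> (u - w - inner \<zeta> (y - v)) / norm (y - v)"
        using n by (simp only: pos_le_divide_eq)
      then show ?thesis using real fv n by simp
    next
      case PInf
      then show ?thesis using fv n by simp
    next
      case MInf
      then show ?thesis using elim by simp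
    qed
  qed
  then have "\<forall>\<^sub>F y in at v. a < ?q y" if "a < 0" for a
    using order_tendstoD(1)[OF lim that] by eventually_elim simp
  then have "0 \<le> Liminf (at v) ?q" by (simp add: le_Liminf_iff)
  then show ?thesis using fv by (simp add: frechet_subdiff_def edom_def)
qed

section \<open>Desingularizing functions\<close>

lemma ereal_less_if_real_le:
  assumes "s \<le> t" "ereal t < \<eta>"
  shows "ereal s < \<eta>"
  using assms by (meson ereal_less_eq(3) le_less_trans)

lemma desingularizing_strict_mono:
  assumes \<phi>: "\<phi> \<in> desingularizing \<eta>"
    and st: "0 \<le> s" "s < t" "ereal t < \<eta>"
  shows "\<phi> s < \<phi> t"
proof -
  have lt: "ereal u < \<eta>" if "u \<le> t" for u
    using that st(3) by (rule ereal_less_if_real_le)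
  show ?thesis
  proof (rule DERIV_pos_imp_increasing_open[OF st(2)])
    fix u assume "s < u" "u < t"
    then have "0 < u" "ereal u < \<eta>" using st lt by auto
    then show "\<exists>y. (\<phi> has_real_derivative y) (at u) \<and> 0 < y"
      using \<phi> by (intro exI[of _ "deriv \<phi> u"])
        (auto simp: desingularizing_def DERIV_deriv_iff_real_differentiable)
  next
    show "continuous_on {s..t} \<phi>"
      using \<phi> st lt unfolding desingularizing_def
      by (auto elim!: continuous_on_subset)
  qed
qed

lemma desingularizing_nonneg:
  assumes "\<phi> \<in> desingularizing \<eta>" "0 \<le> s" "ereal s < \<eta>"
  shows "0 \<le> \<phi> s"
proof (cases "s = 0")
  case True
  then show ?thesis using assms by (simp add: desingularizing_def)
next
  case False
  then have "\<phi> 0 < \<phi> s" using assms(2,3) False by (intro desingularizing_strict_mono[OF assms(1)]) auto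
  then show ?thesis using assms(1) by (simp add: desingularizing_def)
qed

text \<open>
  The tangent inequality is available on intervals having \<open>s\<close> in their interior; since \<open>\<eta>\<close> may be
  infinite, it is applied on a compact interval reaching beyond both \<open>s\<close> and \<open>u\<close>.
\<close>

lemma desingularizing_below_tangent:
  assumes \<phi>: "\<phi> \<in> desingularizing \<eta>"
    and s: "0 < s" "ereal s < \<eta>" and u: "0 \<le> u" "ereal u < \<eta>"
  shows "\<phi> u \<le> \<phi> s + deriv \<phi> s * (u - s)"
proof -
  obtain m where m: "s < m" "u < m" "ereal m < \<eta>"
  proof -
    have "ereal (max s u) < \<eta>" using s u by (simp add: max_def)
    then obtain m where "ereal (max s u) < ereal m" "ereal m < \<eta>"
      using ereal_dense2 by blast
    then show thesis using that by auto
  qed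
  let ?A = "{0..m}"
  have sub: "?A \<subseteq> {s. 0 \<le> s \<and> ereal s < \<eta>}"
    using ereal_less_if_real_le[OF _ m(3)] by auto
  have "concave_on {s. 0 \<le> s \<and> ereal s < \<eta>} \<phi>" using \<phi> by (simp add: desingularizing_def)
  then have cvx: "convex_on ?A (\<lambda>x. - \<phi> x)"
    unfolding concave_on_def using sub by (rule convex_on_subset) simp
  have der: "((\<lambda>x. - \<phi> x) has_real_derivative - deriv \<phi> s) (at s within ?A)"
  proof -
    have "\<phi> differentiable (at s)" using \<phi> s by (simp add: desingularizing_def)
    then have "(\<phi> has_real_derivative deriv \<phi> s) (at s)"
      by (simp add: DERIV_deriv_iff_real_differentiable)
    from has_field_derivative_at_within[OF this] show ?thesis by (rule DERIV_minus)
  qed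
  have "- \<phi> u - - \<phi> s \<ge> - deriv \<phi> s * (u - s)"
    using s m u by (intro convex_on_imp_above_tangent[OF cvx _ _ _ der]) auto
  then show ?thesis by simp
qed

section \<open>The desingularized excess\<close>

text \<open>
  The excess \<open>f y - c\<close>, cut off to the interval from \<open>0\<close> to \<open>m\<close>.  Cutting off before
  subtracting avoids arithmetic with infinite values.
\<close>

definition clamped_excess :: "('a \<Rightarrow> ereal) \<Rightarrow> real \<Rightarrow> real \<Rightarrow> 'a \<Rightarrow> real"
  where "clamped_excess f c m y = real_of_ereal (max (ereal c) (min (f y) (ereal (c + m)))) - c"

lemma clamped_excess_bounds:
  assumes "0 < m"
  shows "0 \<le> clamped_excess f c m y" "clamped_excess f c m y \<le> m"
  using assms by (cases "f y"; simp add: clamped_excess_def max_def min_def)+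

lemma clamped_excess_less_iff:
  assumes "0 \<le> b" "b < m"
  shows "b < clamped_excess f c m y \<longleftrightarrow> ereal (c + b) < f y"
  using assms by (cases "f y") (auto simp: clamped_excess_def max_def min_def)

lemma clamped_excess_eq:
  assumes "f y = ereal w" "c \<le> w" "w \<le> c + m"
  shows "clamped_excess f c m y = w - c"
  using assms by (auto simp: clamped_excess_def max_def min_def)

lemma clamped_excess_le:
  assumes "ereal c \<le> f y"
  shows "ereal (c + clamped_excess f c m y) \<le> f y"
  using assms by (cases "f y") (auto simp: clamped_excess_def max_def min_def)

lemma desingularized_excess_lsc:
  fixes f :: "'a::topological_space \<Rightarrow> ereal"
  assumes lsc: "\<And>a. open {x. a < f x}"
    and \<phi>: "\<phi> \<in> desingularizing \<eta>" and m: "0 < m" "ereal m < \<eta>"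
  shows "open {y. a < \<phi> (clamped_excess f c m y)}"
proof (rule iffD2[OF open_subopen], rule ballI)
  let ?u = "clamped_excess f c m"
  note u = clamped_excess_bounds[OF m(1), of f c]
  have lt: "ereal s < \<eta>" if "s \<le> m" for s
    using that m(2) by (rule ereal_less_if_real_le)
  fix v assume "v \<in> {y. a < \<phi> (?u y)}"
  then have a: "a < \<phi> (?u v)" by simp
  show "\<exists>T. open T \<and> v \<in> T \<and> T \<subseteq> {y. a < \<phi> (?u y)}"
  proof (cases "a < 0")
    case True
    then have "a < \<phi> (?u y)" for y
      using desingularizing_nonneg[OF \<phi> u(1) lt[OF u(2)]] by (rule less_le_trans)
    then show ?thesis by (intro exI[of _ UNIV]) auto
  next
    case False
    let ?k = "(a + \<phi> (?u v)) / 2"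
    have "\<phi> 0 = 0" using \<phi> by (simp add: desingularizing_def)
    moreover have "continuous_on {0..?u v} \<phi>"
      using \<phi> lt u(2)[of v] unfolding desingularizing_def by (auto elim!: continuous_on_subset)
    ultimately obtain b where b: "0 \<le> b" "b \<le> ?u v" "\<phi> b = ?k"
      using IVT'[of \<phi> 0 ?k "?u v"] a False u(1) by auto
    have "b \<noteq> ?u v" using b a by auto
    then have bu: "b < ?u v" using b by simp
    then have bm: "b < m" using u(2)[of v] by linarith
    show ?thesis
    proof (intro exI conjI)
      show "open {y. ereal (c + b) < f y}" by (rule lsc)
      show "v \<in> {y. ereal (c + b) < f y}"
        using bu clamped_excess_less_iff[OF b(1) bm, of f c v] by simp
      show "{y. ereal (c + b) < f y} \<subseteq> {y. a < \<phi> (?u y)}"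
      proof
        fix y assume "y \<in> {y. ereal (c + b) < f y}"
        then have "b < ?u y" using clamped_excess_less_iff[OF b(1) bm, of f c y] by simp
        then have "\<phi> b < \<phi> (?u y)"
          using desingularizing_strict_mono[OF \<phi> b(1) _ lt[OF u(2)]] by blast
        then show "y \<in> {y. a < \<phi> (?u y)}" using a b(3) by simp
      qed
    qed
  qed
qed

lemma edist_set_le:
  assumes "z \<in> A"
  shows "edist_set x A \<le> ereal (norm (x - z))"
  unfolding edist_set_def using assms by (rule INF_lower)

text \<open>
  Write \<open>u y\<close> for the cut-off excess.  Concavity gives
  \<open>\<phi> (u y) - \<phi> s \<le> \<phi>' s * (u y - s)\<close>, so a quadratic minorant of \<open>\<phi> (u y)\<close>, divided by
  \<open>\<phi>' s\<close>, is one of \<open>u y\<close>.  The upper cut-off only decreases the excess.  The lower one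
  could increase it, but not near \<open>v\<close>, where lower semicontinuity keeps \<open>f\<close> above \<open>c\<close>.
\<close>

lemma frechet_subgradient_of_desingularized:
  fixes f :: "'a::real_inner \<Rightarrow> ereal"
  assumes lsc: "\<And>a. open {x. a < f x}"
    and \<phi>: "\<phi> \<in> desingularizing \<eta>" and m: "0 < m" "ereal m < \<eta>"
    and fv: "f v = ereal (c + s)" and s: "0 < s" "s < m"
    and prox: "\<And>y. \<phi> (clamped_excess f c m v) + inner \<xi> (y - v) - K * (norm (y - v))\<^sup>2
                 \<le> \<phi> (clamped_excess f c m y)"
  shows "(1 / deriv \<phi> s) *\<^sub>R \<xi> \<in> frechet_subdiff f v"
proof -
  let ?u = "clamped_excess f c m"
  have lt: "ereal t < \<eta>" if "t \<le> m" for t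
    using that m(2) by (rule ereal_less_if_real_le)
  have uv: "?u v = s" using clamped_excess_eq[of f v "c + s" c m] fv s by simp
  have d: "deriv \<phi> s > 0" using \<phi> s lt by (simp add: desingularizing_def)
  have "v \<in> {y. ereal c < f y}" using fv s by simp
  then have "\<forall>\<^sub>F y in nhds v. y \<in> {y. ereal c < f y}"
    using lsc eventually_nhds by blast
  then have "\<forall>\<^sub>F y in at v. ereal c < f y"
    using eventually_nhds_conv_at by fastforce
  then have "\<forall>\<^sub>F y in at v. ereal (c + s + inner ((1 / deriv \<phi> s) *\<^sub>R \<xi>) (y - v)
      - K / deriv \<phi> s * (norm (y - v))\<^sup>2) \<le> f y"
  proof eventually_elim
    case (elim y)
    have "\<phi> (?u y) \<le> \<phi> s + deriv \<phi> s * (?u y - s)"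
      using desingularizing_below_tangent[OF \<phi>] s lt clamped_excess_bounds[OF m(1), of f c y] by simp
    then have "inner \<xi> (y - v) - K * (norm (y - v))\<^sup>2 \<le> deriv \<phi> s * (?u y - s)"
      using prox[of y] uv by simp
    then have "(inner \<xi> (y - v) - K * (norm (y - v))\<^sup>2) / deriv \<phi> s \<le> ?u y - s"
      using d by (simp add: pos_divide_le_eq mult.commute)
    then have "c + s + inner ((1 / deriv \<phi> s) *\<^sub>R \<xi>) (y - v)
        - K / deriv \<phi> s * (norm (y - v))\<^sup>2 \<le> c + ?u y"
      by (simp add: diff_divide_distrib)
    then have "ereal (c + s + inner ((1 / deriv \<phi> s) *\<^sub>R \<xi>) (y - v)
        - K / deriv \<phi> s * (norm (y - v))\<^sup>2) \<le> ereal (c + ?u y)"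
      by (simp only: ereal_less_eq)
    also have "\<dots> \<le> f y" using elim by (intro clamped_excess_le) simp
    finally show ?case .
  qed
  with fv show ?thesis by (rule frechet_subdiffI_quadratic)
qed

section \<open>The error bound\<close>

theorem theorem2p4:
  fixes f :: "'a::{real_inner, complete_space} \<Rightarrow> ereal"
    and xbar :: 'a
    and r :: real
    and \<eta> :: ereal
    and \<phi> :: "real \<Rightarrow> real"
  assumes "proper f"
    and "weakly_lsc f"
    and "xbar \<in> edom f"
    and "r > 0"
    and "\<eta> > 0"
    and "\<phi> \<in> desingularizing \<eta>"
    and "\<And>x. x \<in> ball xbar r \<Longrightarrow> f xbar < f x \<Longrightarrow> f x < f xbar + \<eta> \<Longrightarrow>
           ereal (deriv \<phi> (real_of_ereal (f x - f xbar))) * edist_set 0 (frechet_subdiff f x) \<ge> 1"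
  shows "\<exists>r' \<eta>'. 0 < r' \<and> r' \<le> r \<and> 0 < \<eta>' \<and> \<eta>' \<le> \<eta> \<and>
           (\<forall>x \<in> ball xbar r'. f xbar \<le> f x \<and> f x < f xbar + \<eta>' \<longrightarrow>
              edist_set x {z. f z \<le> f xbar} \<le> ereal (2 * \<phi> (real_of_ereal (f x - f xbar))))"
proof -
  let ?S = "{z. f z \<le> f xbar}"
  note \<phi> = assms(6) and error_bound = assms(7)
  have lsc: "open {x. a < f x}" for a
    using assms(2) by (rule weakly_lsc_imp_open_superlevel)
  obtain c where c: "f xbar = ereal c"
    using assms(1,3) by (cases "f xbar") (auto simp: proper_def edom_def)
  have bound: "edist_set x ?S \<le> ereal (2 * \<phi> (real_of_ereal (f x - f xbar)))"
    if x: "x \<in> ball xbar (r / 2)" and ge: "f xbar \<le> f x" and less: "f x < f xbar + \<eta>" for x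
  proof (cases "f x = f xbar")
    case True
    then show ?thesis
      using edist_set_le[of x ?S x] assms(6) c by (simp add: desingularizing_def zero_ereal_def)
  next
    case False
    obtain w where w: "f x = ereal (c + w)" "0 < w" "ereal w < \<eta>"
    proof -
      obtain w' where w': "f x = ereal w'" using ge less c by (cases "f x") auto
      show thesis
      proof (rule that[of "w' - c"])
        show "f x = ereal (c + (w' - c))" using w' by simp
        show "0 < w' - c" using w' c ge False by simp
        show "ereal (w' - c) < \<eta>" using w' c less by (cases \<eta>) auto
      qed
    qed
    define t where "t = \<phi> w"
    have w_eq: "real_of_ereal (f x - f xbar) = w" using w c by simp
    have t: "t > 0"
      using desingularizing_strict_mono[OF \<phi>, of 0 w] w \<phi>
      by (simp add: t_def desingularizing_def)
    \<comment> \<open>The cut-off must lie strictly above the excess of \<open>x\<close>, so that it is inactive at every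
      point where \<open>H\<close> is at most \<open>t\<close>.\<close>
    obtain m where m: "w < m" "ereal m < \<eta>"
      using ereal_dense2[OF w(3)] by auto
    have lt: "ereal u < \<eta>" if "u \<le> m" for u
      using that m(2) by (rule ereal_less_if_real_le)
    have m0: "0 < m" using m w by simp
    define H where "H y = \<phi> (clamped_excess f c m y)" for y
    note u = clamped_excess_bounds[OF m0, of f c]
    have H_nonneg: "0 \<le> H y" for y
      unfolding H_def using \<phi> u(1) lt[OF u(2)] by (rule desingularizing_nonneg)
    have Hx: "H x = t"
      using clamped_excess_eq[of f x "c + w" c m] w m by (simp add: H_def t_def)
    show ?thesis
    proof (rule ccontr)
      assume "\<not> ?thesis"
      then have "ereal (2 * t) < edist_set x ?S" by (simp add: w_eq t_def not_le)
      then obtain \<rho> where \<rho>: "2 * t < \<rho>" "ereal \<rho> < edist_set x ?S"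
        using ereal_dense2 by force
      have far: "\<rho> < norm (x - z)" if "f z \<le> f xbar" for z
        using less_le_trans[OF \<rho>(2) edist_set_le[of z ?S x]] that by simp
      have \<rho>0: "\<rho> > 0" using \<rho>(1) t by linarith
      \<comment> \<open>With this \<open>k\<close> the penalty exceeds \<open>t\<close> outside the ball of radius \<open>\<rho>\<close>, while inside its
        gradient is at most \<open>2 * t / \<rho>\<close>; \<open>\<epsilon>\<close> is half of what then remains up to \<open>1\<close>.\<close>
      define k where "k = t / \<rho>\<^sup>2"
      define \<epsilon> where "\<epsilon> = (1 - 2 * t / \<rho>) / 2"
      have k: "k > 0" using t \<rho>0 by (simp add: k_def)
      have "2 * t / \<rho> < 1" using \<rho>(1) \<rho>0 by simp
      then have \<epsilon>: "\<epsilon> > 0" and \<epsilon>_less: "\<epsilon> + 2 * t / \<rho> < 1"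
        by (simp_all add: \<epsilon>_def field_simps)
      define G where "G y = H y + k * (norm (y - x))\<^sup>2" for y
      have G_lsc: "open {y. a < G y}" for a
      proof -
        \<comment> \<open>A sum exceeds \<open>a\<close> iff some level \<open>b\<close> splits the excess between its two terms.\<close>
        have "{y. a < G y} = (\<Union>b. {y. b < H y} \<inter> {y. a - b < k * (norm (y - x))\<^sup>2})"
        proof (intro equalityI subsetI)
          fix y assume "y \<in> {y. a < G y}"
          then have "a - k * (norm (y - x))\<^sup>2 < H y" by (simp add: G_def)
          then obtain b where "a - k * (norm (y - x))\<^sup>2 < b" "b < H y"
            using dense by blast
          then have "b < H y" "a - b < k * (norm (y - x))\<^sup>2" by auto
          then show "y \<in> (\<Union>b. {y. b < H y} \<inter> {y. a - b < k * (norm (y - x))\<^sup>2})" by blast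
        qed (auto simp: G_def)
        moreover have "open {y. b < H y}" for b
          unfolding H_def by (rule desingularized_excess_lsc[OF lsc \<phi> m0 m(2)])
        moreover have "open {y. a - b < k * (norm (y - x))\<^sup>2}" for b
          by (intro open_Collect_less continuous_intros)
        ultimately show ?thesis by (simp only: open_UN open_Int ball_simps simp_thms)
      qed
      have "0 \<le> G y" for y using H_nonneg[of y] k by (simp add: G_def)
      then obtain v p where v: "G v \<le> G x" and p: "norm p \<le> \<epsilon>"
        and prox: "\<And>y. G v + inner p (y - v) - \<epsilon> * (norm (y - v))\<^sup>2 \<le> G y"
        using small_proximal_subgradient_exists[OF G_lsc, of 0 \<epsilon>, OF _ \<epsilon>] by blast
      have Gv: "H v + k * (norm (v - x))\<^sup>2 \<le> t"
        using v by (simp add: G_def Hx)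
      have "k * (norm (v - x))\<^sup>2 \<le> t" using Gv H_nonneg[of v] by linarith
      then have "(norm (v - x))\<^sup>2 \<le> \<rho>\<^sup>2" using t \<rho>0 by (simp add: k_def pos_divide_le_eq)
      then have vx: "norm (v - x) \<le> \<rho>" by (rule power2_le_imp_le) (use \<rho>0 in simp)
      have above: "f xbar < f v"
        using far[of v] vx by (auto simp: norm_minus_commute not_le[symmetric])
      have "clamped_excess f c m v \<le> w"
      proof (rule ccontr)
        assume "\<not> ?thesis"
        then have "t < H v"
          using desingularizing_strict_mono[OF \<phi> _ _ lt[OF u(2)]] w unfolding t_def H_def by simp
        moreover have "0 \<le> k * (norm (v - x))\<^sup>2" using k by simp
        ultimately show False using Gv by linarith
      qed
      then have "\<not> ereal (c + w) < f v"
        using clamped_excess_less_iff[of w m f c v] w m by simp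
      moreover from this above c obtain s' where "f v = ereal s'" by (cases "f v") auto
      ultimately obtain s where s: "f v = ereal (c + s)" "0 < s" "s \<le> w"
        using above c that[of "s' - c"] by simp
      define \<xi> where "\<xi> = p - (2 * k) *\<^sub>R (v - x)"
      have "H v + inner \<xi> (y - v) - (\<epsilon> + k) * (norm (y - v))\<^sup>2 \<le> H y" for y
      proof -
        have "k * (norm (y - x))\<^sup>2
            = k * (norm (v - x))\<^sup>2 + 2 * k * inner (v - x) (y - v) + k * (norm (y - v))\<^sup>2"
          by (simp add: power2_norm_eq_inner inner_diff inner_commute algebra_simps)
        moreover have "inner \<xi> (y - v) = inner p (y - v) - 2 * k * inner (v - x) (y - v)"
          by (simp add: \<xi>_def inner_diff_left)
        ultimately show ?thesis using prox[of y] unfolding G_def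
          by (simp add: distrib_right)
      qed
      then have sub: "(1 / deriv \<phi> s) *\<^sub>R \<xi> \<in> frechet_subdiff f v"
        unfolding H_def using s m
        by (intro frechet_subgradient_of_desingularized[OF lsc \<phi> m0 m(2)]) auto
      have d: "deriv \<phi> s > 0" using \<phi> s lt m by (simp add: desingularizing_def)
      have "norm \<xi> \<le> norm p + 2 * k * norm (v - x)"
        using norm_triangle_ineq4[of p "(2 * k) *\<^sub>R (v - x)"] k by (simp add: \<xi>_def)
      also have "\<dots> \<le> \<epsilon> + 2 * k * \<rho>"
        using p vx k by (intro add_mono mult_left_mono) auto
      also have "2 * k * \<rho> = 2 * t / \<rho>" using \<rho>0 by (simp add: k_def power2_eq_square)
      finally have \<xi>: "norm \<xi> < 1" using \<epsilon>_less by linarith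
      have "\<rho> < norm (x - xbar)" by (rule far) simp
      then have "v \<in> ball xbar r"
        using x vx norm_triangle_ineq[of "x - xbar" "v - x"]
        by (simp add: dist_norm norm_minus_commute)
      moreover have "f v < f xbar + \<eta>"
        using s lt[of s] m c by (cases \<eta>) auto
      ultimately have "1 \<le> ereal (deriv \<phi> s) * edist_set 0 (frechet_subdiff f v)"
        using error_bound[of v] above s(1) c by simp
      also have "\<dots> \<le> ereal (deriv \<phi> s) * ereal (norm (0 - (1 / deriv \<phi> s) *\<^sub>R \<xi>))"
        using edist_set_le[OF sub, of 0] d by (intro ereal_mult_left_mono) auto
      also have "\<dots> = ereal (norm \<xi>)" using d by simp
      finally show False using \<xi> by (simp add: one_ereal_def)
    qed
  qed
  show ?thesis
    using assms(4,5) bound by (intro exI[of _ "r / 2"] exI[of _ \<eta>]) auto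
qed

end
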